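(* Let $G$ be a discrete group. Each non-empty $G$-invariant open subset of $\beta G$ on which $G$ acts co-compactly is equal to $X_A=\bigcup_{g\in G}K_{gA}$ for some non-empty $A\subseteq G$.
   Context: $\beta G$ is the Stone–Čech compactification of the discrete space $G$, with the $G$-action extending left multiplication of $G$ on itself. For $B\subseteq G$, $K_B$ denotes the closure of $B$ in $\beta G$. The action of $G$ on a locally compact Hausdorff space $X$ is co-compact if there is a compact $K\subseteq X$ with $\bigcup_{g\in G}g.K=X$. *)

theory Defs
  imports "HOL-Analysis.Analysis" "HOL-Algebra.Coset"
begin

section \<open>The Stone--Cech compactification of a discrete space\<close>

text \<open>
  The Stone--Cech compactification of a discrete space \<open>S\<close> is realised as the space of
  ultrafilters on \<open>S\<close>, and \<open>S\<close> is embedded into it by means of principal ultrafilters.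
  That this really is the Stone--Cech compactification (a compact Hausdorff space with \<open>S\<close>
  as a dense discrete subspace, to which every map from \<open>S\<close> to a compact Hausdorff space
  extends uniquely) is proved below.
\<close>

definition ultrafilter_on :: "'a set \<Rightarrow> 'a set set \<Rightarrow> bool" where
  "ultrafilter_on S p \<longleftrightarrow>
     p \<subseteq> Pow S \<and> S \<in> p \<and> {} \<notin> p \<and>
     (\<forall>A\<in>p. \<forall>B\<in>p. A \<inter> B \<in> p) \<and>
     (\<forall>A\<in>p. \<forall>B. A \<subseteq> B \<and> B \<subseteq> S \<longrightarrow> B \<in> p) \<and>
     (\<forall>A. A \<subseteq> S \<longrightarrow> A \<in> p \<or> S - A \<in> p)"

definition principal_ultrafilter :: "'a set \<Rightarrow> 'a \<Rightarrow> 'a set set" where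
  "principal_ultrafilter S x = {A. A \<subseteq> S \<and> x \<in> A}"

definition ultrafilters_containing :: "'a set \<Rightarrow> 'a set \<Rightarrow> 'a set set set" where
  "ultrafilters_containing S A = {p. ultrafilter_on S p \<and> A \<in> p}"

definition stone_cech :: "'a set \<Rightarrow> 'a set set topology" where
  "stone_cech S = topology_generated_by {ultrafilters_containing S A | A. A \<subseteq> S}"

lemma ultrafilter_onD:
  assumes "ultrafilter_on S p"
  shows "A \<in> p \<Longrightarrow> A \<subseteq> S" "S \<in> p" "{} \<notin> p"
    "A \<in> p \<Longrightarrow> B \<in> p \<Longrightarrow> A \<inter> B \<in> p"
    "A \<in> p \<Longrightarrow> A \<subseteq> B \<Longrightarrow> B \<subseteq> S \<Longrightarrow> B \<in> p"
    "A \<subseteq> S \<Longrightarrow> A \<notin> p \<Longrightarrow> S - A \<in> p"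
proof -
  from assms have u: "p \<subseteq> Pow S" "S \<in> p" "{} \<notin> p"
    "\<forall>A\<in>p. \<forall>B\<in>p. A \<inter> B \<in> p" "\<forall>A\<in>p. \<forall>B. A \<subseteq> B \<and> B \<subseteq> S \<longrightarrow> B \<in> p"
    "\<forall>A. A \<subseteq> S \<longrightarrow> A \<in> p \<or> S - A \<in> p"
    unfolding ultrafilter_on_def by simp_all
  show "A \<in> p \<Longrightarrow> A \<subseteq> S" using u(1) by blast
  show "S \<in> p" "{} \<notin> p" using u(2,3) .
  show "A \<in> p \<Longrightarrow> B \<in> p \<Longrightarrow> A \<inter> B \<in> p" using u(4) by simp
  show "A \<in> p \<Longrightarrow> A \<subseteq> B \<Longrightarrow> B \<subseteq> S \<Longrightarrow> B \<in> p" using u(5) by simp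
  show "A \<subseteq> S \<Longrightarrow> A \<notin> p \<Longrightarrow> S - A \<in> p" using u(6) by blast
qed

lemma ultrafilter_on_disjoint:
  assumes "ultrafilter_on S p" "A \<in> p" "B \<in> p" shows "A \<inter> B \<noteq> {}"
  using ultrafilter_onD(4)[OF assms] ultrafilter_onD(3)[OF assms(1)] by metis

lemma ultrafilter_on_Union:
  assumes p: "ultrafilter_on S p" and "finite X" "X \<subseteq> Pow S" "\<Union>X \<in> p"
  shows "\<exists>A\<in>X. A \<in> p"
  using assms(2-)
proof (induction X rule: finite_induct)
  case empty
  then show ?case using ultrafilter_onD(3)[OF p] by simp
next
  case (insert A X)
  show ?case
  proof (cases "A \<in> p")
    case False
    then have "S - A \<in> p" using ultrafilter_onD(6)[OF p, of A] insert.prems(1) by blast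
    then have "(S - A) \<inter> \<Union>(insert A X) \<in> p" using ultrafilter_onD(4)[OF p] insert.prems(2) by blast
    moreover have "(S - A) \<inter> \<Union>(insert A X) \<subseteq> \<Union>X" by blast
    moreover have "\<Union>X \<subseteq> S" using insert.prems(1) by blast
    ultimately have "\<Union>X \<in> p" by (rule ultrafilter_onD(5)[OF p])
    then have "\<exists>A\<in>X. A \<in> p" using insert.IH insert.prems(1) by blast
    then show ?thesis by blast
  qed blast
qed

lemma ultrafilter_on_principal: "x \<in> S \<Longrightarrow> ultrafilter_on S (principal_ultrafilter S x)"
  by (auto simp: ultrafilter_on_def principal_ultrafilter_def)

lemma ultrafilter_on_extension:
  assumes F: "F \<subseteq> Pow S" and fip: "\<And>X. finite X \<Longrightarrow> X \<subseteq> F \<Longrightarrow> S \<inter> \<Inter>X \<noteq> {}"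
  shows "\<exists>p. ultrafilter_on S p \<and> F \<subseteq> p"
proof -
  define P where "P = {M. F \<subseteq> M \<and> M \<subseteq> Pow S \<and> (\<forall>X. finite X \<and> X \<subseteq> M \<longrightarrow> S \<inter> \<Inter>X \<noteq> {})}"
  have PI: "M \<in> P" if "F \<subseteq> M" "M \<subseteq> Pow S" "\<And>X. finite X \<Longrightarrow> X \<subseteq> M \<Longrightarrow> S \<inter> \<Inter>X \<noteq> {}" for M
    using that unfolding P_def mem_Collect_eq by (intro conjI allI impI) simp_all
  have PD: "F \<subseteq> M" "M \<subseteq> Pow S" "finite X \<Longrightarrow> X \<subseteq> M \<Longrightarrow> S \<inter> \<Inter>X \<noteq> {}" if "M \<in> P" for M X
    using that unfolding P_def mem_Collect_eq by simp_all
  have "\<exists>M\<in>P. \<forall>X\<in>P. M \<subseteq> X \<longrightarrow> X = M"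
  proof (rule subset_Zorn_nonempty)
    show "P \<noteq> {}" using PI[OF order_refl F fip] by blast
    fix C assume C: "C \<noteq> {}" "subset.chain P C"
    then have CP: "C \<subseteq> P" by (simp add: subset_chain_def)
    have "S \<inter> \<Inter>X \<noteq> {}" if X: "finite X" "X \<subseteq> \<Union>C" for X
    proof -
      obtain B where "B \<in> C" "X \<subseteq> B" using finite_subset_Union_chain[OF X C] by blast
      then show ?thesis using PD(3)[of B X] CP X(1) by blast
    qed
    moreover obtain B where "B \<in> C" using C(1) by blast
    then have "F \<subseteq> \<Union>C" using PD(1)[of B] CP by blast
    moreover have "\<Union>C \<subseteq> Pow S" using PD(2) CP by (intro Union_least) auto
    ultimately show "\<Union>C \<in> P" by (intro PI)
  qed
  then obtain M where M: "M \<in> P" and max: "\<And>X. X \<in> P \<Longrightarrow> M \<subseteq> X \<Longrightarrow> X = M" by blast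
  have mem: "A \<in> M" if A: "A \<subseteq> S" and ne: "\<And>X. finite X \<Longrightarrow> X \<subseteq> M \<Longrightarrow> S \<inter> A \<inter> \<Inter>X \<noteq> {}" for A
  proof -
    have "S \<inter> \<Inter>X \<noteq> {}" if X: "finite X" "X \<subseteq> insert A M" for X
    proof -
      have "S \<inter> A \<inter> \<Inter>(X - {A}) \<noteq> {}" using X by (intro ne) auto
      then show ?thesis by auto
    qed
    moreover have "F \<subseteq> insert A M" "insert A M \<subseteq> Pow S" using PD(1,2)[OF M] A by auto
    ultimately have "insert A M \<in> P" by (intro PI)
    then show ?thesis using max[of "insert A M"] by blast
  qed
  have MP: "S \<inter> \<Inter>X \<noteq> {}" if "finite X" "X \<subseteq> M" for X using PD(3)[OF M that] .
  have MS: "A \<subseteq> S" if "A \<in> M" for A using PD(2)[OF M] that by blast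
  have "ultrafilter_on S M"
    unfolding ultrafilter_on_def
  proof (intro conjI ballI allI impI)
    show "M \<subseteq> Pow S" using MS by blast
    show "S \<in> M" using mem[of S] MP by simp
    show "{} \<notin> M" using MP[of "{{}}"] by auto
    show "A \<inter> B \<in> M" if "A \<in> M" "B \<in> M" for A B
    proof (rule mem)
      show "A \<inter> B \<subseteq> S" using MS that by blast
      fix X assume "finite X" "X \<subseteq> M"
      then show "S \<inter> (A \<inter> B) \<inter> \<Inter>X \<noteq> {}" using MP[of "insert A (insert B X)"] that by auto
    qed
    show "B \<in> M" if "A \<in> M" "A \<subseteq> B \<and> B \<subseteq> S" for A B
    proof (rule mem)
      show "B \<subseteq> S" using that by blast
      fix X assume "finite X" "X \<subseteq> M"
      then show "S \<inter> B \<inter> \<Inter>X \<noteq> {}" using MP[of "insert A X"] that by auto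
    qed
    show "A \<in> M \<or> S - A \<in> M" if A: "A \<subseteq> S" for A
    proof (rule ccontr)
      assume "\<not> (A \<in> M \<or> S - A \<in> M)"
      then have "A \<notin> M" "S - A \<notin> M" by auto
      obtain X where X: "finite X" "X \<subseteq> M" "S \<inter> A \<inter> \<Inter>X = {}"
        using mem[OF A] \<open>A \<notin> M\<close> by metis
      obtain Y where Y: "finite Y" "Y \<subseteq> M" "S \<inter> (S - A) \<inter> \<Inter>Y = {}"
        using mem[OF Diff_subset] \<open>S - A \<notin> M\<close> by metis
      have "S \<inter> \<Inter>(X \<union> Y) \<noteq> {}" using X Y by (intro MP) auto
      then show False using X(3) Y(3) by blast
    qed
  qed
  then show ?thesis using PD(1)[OF M] by blast
qed

lemma topspace_stone_cech: "topspace (stone_cech S) = {p. ultrafilter_on S p}"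
  unfolding stone_cech_def
  unfolding topology_generated_by_topspace
proof (intro equalityI subsetI)
  fix p assume "p \<in> {p. ultrafilter_on S p}"
  then have "p \<in> ultrafilters_containing S S"
    using ultrafilter_onD(2) by (simp add: ultrafilters_containing_def)
  then show "p \<in> \<Union>{ultrafilters_containing S A | A. A \<subseteq> S}" by blast
qed (auto simp: ultrafilters_containing_def)

lemma openin_ultrafilters_containing:
  "A \<subseteq> S \<Longrightarrow> openin (stone_cech S) (ultrafilters_containing S A)"
  unfolding stone_cech_def by (rule topology_generated_by_Basis) auto

lemma stone_cech_base:
  assumes "openin (stone_cech S) U" "p \<in> U"
  shows "\<exists>A\<in>p. ultrafilters_containing S A \<subseteq> U"
proof -
  have "generate_topology_on {ultrafilters_containing S A | A. A \<subseteq> S} U"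
    using assms(1) unfolding stone_cech_def by (simp add: openin_topology_generated_by_iff)
  then show ?thesis using assms(2)
  proof induction
    case (Int a b)
    then have "openin (stone_cech S) a"
      unfolding stone_cech_def by (simp add: openin_topology_generated_by_iff)
    then have "p \<in> topspace (stone_cech S)"
      using openin_subset Int.prems by blast
    then have p: "ultrafilter_on S p" by (simp add: topspace_stone_cech)
    obtain A where A: "A \<in> p" "ultrafilters_containing S A \<subseteq> a" using Int.IH(1) Int.prems by blast
    obtain B where B: "B \<in> p" "ultrafilters_containing S B \<subseteq> b" using Int.IH(2) Int.prems by blast
    have "A \<inter> B \<in> p" by (rule ultrafilter_onD(4)[OF p A(1) B(1)])
    moreover have "ultrafilters_containing S (A \<inter> B) \<subseteq> a \<inter> b"
    proof
      fix q assume "q \<in> ultrafilters_containing S (A \<inter> B)"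
      then have q: "ultrafilter_on S q" "A \<inter> B \<in> q" by (auto simp: ultrafilters_containing_def)
      have "A \<in> q" "B \<in> q"
        using ultrafilter_onD(5)[OF q] ultrafilter_onD(1)[OF p A(1)] ultrafilter_onD(1)[OF p B(1)]
        by simp_all
      then have "q \<in> ultrafilters_containing S A" "q \<in> ultrafilters_containing S B"
        using q(1) by (simp_all add: ultrafilters_containing_def)
      then show "q \<in> a \<inter> b" using A(2) B(2) by blast
    qed
    ultimately show ?case by blast
  next
    case (UN K)
    then obtain k where "k \<in> K" "p \<in> k" by blast
    then obtain A where "A \<in> p" "ultrafilters_containing S A \<subseteq> k" using UN.IH by blast
    then show ?case using \<open>k \<in> K\<close> by blast
  next
    case (Basis s)
    then obtain A where "s = ultrafilters_containing S A" by blast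
    then show ?case using Basis.prems by (auto simp: ultrafilters_containing_def)
  qed simp
qed

lemma compact_space_stone_cech: "compact_space (stone_cech S)"
  unfolding compact_space_alt
proof (intro allI impI, elim conjE)
  fix \<U> assume op: "\<forall>U\<in>\<U>. openin (stone_cech S) U" and cov: "topspace (stone_cech S) \<subseteq> \<Union>\<U>"
  show "\<exists>\<F>. finite \<F> \<and> \<F> \<subseteq> \<U> \<and> topspace (stone_cech S) \<subseteq> \<Union>\<F>"
  proof (rule ccontr)
    assume neg: "\<nexists>\<F>. finite \<F> \<and> \<F> \<subseteq> \<U> \<and> topspace (stone_cech S) \<subseteq> \<Union>\<F>"
    define H where "H = {A. A \<subseteq> S \<and> (\<exists>U\<in>\<U>. ultrafilters_containing S A \<subseteq> U)}"
    have "\<exists>p. ultrafilter_on S p \<and> (\<lambda>A. S - A) ` H \<subseteq> p"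
    proof (rule ultrafilter_on_extension)
      fix X assume "finite X" "X \<subseteq> (\<lambda>A. S - A) ` H"
      then obtain Y where Y: "finite Y" "Y \<subseteq> H" "X = (\<lambda>A. S - A) ` Y"
        by (meson finite_subset_image)
      have "\<forall>A\<in>Y. \<exists>U. U \<in> \<U> \<and> ultrafilters_containing S A \<subseteq> U"
        using Y(2) unfolding H_def by blast
      then obtain u where u: "\<And>A. A \<in> Y \<Longrightarrow> u A \<in> \<U> \<and> ultrafilters_containing S A \<subseteq> u A"
        by metis
      show "S \<inter> \<Inter>X \<noteq> {}"
      proof
        assume "S \<inter> \<Inter>X = {}"
        moreover have YS: "Y \<subseteq> Pow S" using Y(2) unfolding H_def by blast
        ultimately have "\<Union>Y = S" using Y(3) by auto
        have "topspace (stone_cech S) \<subseteq> \<Union>(u ` Y)"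
        proof
          fix p assume "p \<in> topspace (stone_cech S)"
          then have p: "ultrafilter_on S p" by (simp add: topspace_stone_cech)
          then obtain A where A: "A \<in> Y" "A \<in> p"
            using ultrafilter_on_Union[OF p Y(1) YS] ultrafilter_onD(2)[OF p] \<open>\<Union>Y = S\<close> by auto
          then have "p \<in> ultrafilters_containing S A"
            using p by (simp add: ultrafilters_containing_def)
          then show "p \<in> \<Union>(u ` Y)" using u[OF A(1)] A(1) by blast
        qed
        moreover have "finite (u ` Y)" "u ` Y \<subseteq> \<U>" using Y(1) u by auto
        ultimately show False using neg by blast
      qed
    qed auto
    then obtain p where p: "ultrafilter_on S p" "(\<lambda>A. S - A) ` H \<subseteq> p" by blast
    then obtain U where U: "U \<in> \<U>" "p \<in> U" using cov by (auto simp: topspace_stone_cech)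
    then obtain A where A: "A \<in> p" "ultrafilters_containing S A \<subseteq> U"
      using stone_cech_base op by blast
    then have "A \<in> H" using U ultrafilter_onD(1)[OF p(1)] unfolding H_def by blast
    then have "S - A \<in> p" using p(2) by blast
    then show False using ultrafilter_on_disjoint[OF p(1) A(1)] by blast
  qed
qed

lemma Hausdorff_space_stone_cech: "Hausdorff_space (stone_cech S)"
  unfolding Hausdorff_space_def
proof (intro allI impI, elim conjE)
  fix p q assume pq: "p \<in> topspace (stone_cech S)" "q \<in> topspace (stone_cech S)" "p \<noteq> q"
  then have u: "ultrafilter_on S p" "ultrafilter_on S q" by (auto simp: topspace_stone_cech)
  have "\<exists>A. A \<in> p \<and> S - A \<in> q"
  proof (rule ccontr)
    assume neg: "\<nexists>A. A \<in> p \<and> S - A \<in> q"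
    then have "p \<subseteq> q" using ultrafilter_onD(1)[OF u(1)] ultrafilter_onD(6)[OF u(2)] by blast
    moreover have "q \<subseteq> p"
    proof
      fix A assume A: "A \<in> q"
      then have "A \<subseteq> S" using ultrafilter_onD(1)[OF u(2)] by blast
      then show "A \<in> p" using neg A ultrafilter_onD(6)[OF u(1), of A] by (metis double_diff subset_refl)
    qed
    ultimately show False using pq(3) by blast
  qed
  then obtain A where A: "A \<in> p" "S - A \<in> q" by blast
  have "disjnt (ultrafilters_containing S A) (ultrafilters_containing S (S - A))"
    using ultrafilter_on_disjoint[of S _ A "S - A"]
    unfolding disjnt_def ultrafilters_containing_def by blast
  moreover have "A \<subseteq> S" using A ultrafilter_onD(1)[OF u(1)] by blast
  ultimately show "\<exists>U V. openin (stone_cech S) U \<and> openin (stone_cech S) V \<and> p \<in> U \<and> q \<in> V \<and> disjnt U V"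
    using A u openin_ultrafilters_containing[of A S] openin_ultrafilters_containing[of "S - A" S]
    unfolding ultrafilters_containing_def by blast
qed

lemma stone_cech_dense:
  "stone_cech S closure_of (principal_ultrafilter S ` S) = topspace (stone_cech S)"
proof (intro equalityI closure_of_subset_topspace subsetI)
  fix p assume p: "p \<in> topspace (stone_cech S)"
  have "\<exists>y. y \<in> principal_ultrafilter S ` S \<and> y \<in> T"
    if T: "p \<in> T" "openin (stone_cech S) T" for T
  proof -
    obtain A where A: "A \<in> p" "ultrafilters_containing S A \<subseteq> T" using stone_cech_base T by blast
    have u: "ultrafilter_on S p" using p by (simp add: topspace_stone_cech)
    have "A \<subseteq> S" "A \<noteq> {}" using A(1) ultrafilter_onD(1,3)[OF u] by auto
    then obtain x where "x \<in> A" "x \<in> S" by blast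
    then have "principal_ultrafilter S x \<in> T"
      using A(2) ultrafilter_on_principal[of x S] \<open>A \<subseteq> S\<close>
      unfolding ultrafilters_containing_def principal_ultrafilter_def by blast
    then show ?thesis using \<open>x \<in> S\<close> by blast
  qed
  then show "p \<in> stone_cech S closure_of (principal_ultrafilter S ` S)"
    using p unfolding in_closure_of by blast
qed

lemma embedding_map_principal_ultrafilter:
  "embedding_map (discrete_topology S) (stone_cech S) (principal_ultrafilter S)"
proof (rule injective_open_imp_embedding_map)
  show "continuous_map (discrete_topology S) (stone_cech S) (principal_ultrafilter S)"
    by (auto simp: topspace_stone_cech ultrafilter_on_principal)
  show "inj_on (principal_ultrafilter S) (topspace (discrete_topology S))"
  proof (rule inj_onI)
    fix x y assume "x \<in> topspace (discrete_topology S)"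
      and eq: "principal_ultrafilter S x = principal_ultrafilter S y"
    have "{x} \<in> principal_ultrafilter S x"
      using \<open>x \<in> topspace (discrete_topology S)\<close> by (simp add: principal_ultrafilter_def)
    then have "{x} \<in> principal_ultrafilter S y" by (simp only: eq)
    then show "x = y" by (simp add: principal_ultrafilter_def)
  qed
  show "open_map (discrete_topology S) (stone_cech S) (principal_ultrafilter S)"
    unfolding open_map_def
  proof (intro allI impI)
    fix U assume "openin (discrete_topology S) U"
    then have U: "U \<subseteq> S" by simp
    have "ultrafilters_containing S {x} = {principal_ultrafilter S x}" if x: "x \<in> S" for x
    proof -
      have "p = principal_ultrafilter S x" if p: "ultrafilter_on S p" "{x} \<in> p" for p
      proof -
        have "x \<in> A" if "A \<in> p" for A using ultrafilter_on_disjoint[OF p that] by blast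
        then show ?thesis
          using ultrafilter_onD(1)[OF p(1)] ultrafilter_onD(5)[OF p(1) p(2)]
          unfolding principal_ultrafilter_def by auto
      qed
      moreover have "{x} \<in> principal_ultrafilter S x"
        using x by (simp add: principal_ultrafilter_def)
      ultimately show ?thesis
        using ultrafilter_on_principal[OF x] unfolding ultrafilters_containing_def by blast
    qed
    then have "principal_ultrafilter S ` U = (\<Union>x\<in>U. ultrafilters_containing S {x})"
      using U by auto
    then show "openin (stone_cech S) (principal_ultrafilter S ` U)"
      using U by (auto intro!: openin_ultrafilters_containing)
  qed
qed

text \<open>The universal property of the Stone--Cech compactification.\<close>

lemma stone_cech_extension:
  assumes Z: "compact_space Z" "Hausdorff_space Z"
    and f: "continuous_map (discrete_topology S) Z f"
  shows "\<exists>h. continuous_map (stone_cech S) Z h \<and> (\<forall>x\<in>S. h (principal_ultrafilter S x) = f x)"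
proof -
  have fS: "f x \<in> topspace Z" if "x \<in> S" for x using f that by auto
  have "\<exists>z\<in>topspace Z. \<forall>W. openin Z W \<and> z \<in> W \<longrightarrow> {x\<in>S. f x \<in> W} \<in> p"
    if p: "ultrafilter_on S p" for p
  proof (rule ccontr)
    assume neg: "\<not> ?thesis"
    define \<U> where "\<U> = {W. openin Z W \<and> {x\<in>S. f x \<in> W} \<notin> p}"
    have "topspace Z \<subseteq> \<Union>\<U>" "\<forall>U\<in>\<U>. openin Z U" using neg unfolding \<U>_def by blast+
    then obtain \<F> where F: "finite \<F>" "\<F> \<subseteq> \<U>" "topspace Z \<subseteq> \<Union>\<F>"
      using Z(1) unfolding compact_space_alt by meson
    have "\<Union>((\<lambda>W. {x\<in>S. f x \<in> W}) ` \<F>) = S" using F(3) fS by blast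
    then show False
      using ultrafilter_on_Union[OF p, of "(\<lambda>W. {x\<in>S. f x \<in> W}) ` \<F>"] F ultrafilter_onD(2)[OF p]
      unfolding \<U>_def by auto
  qed
  then obtain h where h: "\<And>p. ultrafilter_on S p \<Longrightarrow> h p \<in> topspace Z"
    and hW: "\<And>p W. ultrafilter_on S p \<Longrightarrow> openin Z W \<Longrightarrow> h p \<in> W \<Longrightarrow> {x\<in>S. f x \<in> W} \<in> p"
    by metis
  have "h (principal_ultrafilter S x) = f x" if x: "x \<in> S" for x
  proof (rule ccontr)
    assume "h (principal_ultrafilter S x) \<noteq> f x"
    then obtain U V where UV: "openin Z U" "openin Z V" "h (principal_ultrafilter S x) \<in> U"
      "f x \<in> V" "disjnt U V"
      using Z(2) h[OF ultrafilter_on_principal[OF x]] fS[OF x] unfolding Hausdorff_space_def by meson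
    then have "f x \<in> U"
      using hW[OF ultrafilter_on_principal[OF x] UV(1)] by (simp add: principal_ultrafilter_def)
    then show False using UV by (auto simp: disjnt_def)
  qed
  moreover have "continuous_map (stone_cech S) Z h"
    unfolding continuous_map
  proof (intro conjI allI impI)
    show "h ` topspace (stone_cech S) \<subseteq> topspace Z" using h by (auto simp: topspace_stone_cech)
    fix W assume W: "openin Z W"
    show "openin (stone_cech S) {p \<in> topspace (stone_cech S). h p \<in> W}"
    proof (subst openin_subopen, intro ballI)
      fix p assume "p \<in> {p \<in> topspace (stone_cech S). h p \<in> W}"
      then have p: "ultrafilter_on S p" "h p \<in> W" by (auto simp: topspace_stone_cech)
      have "neighbourhood_base_of (closedin Z) Z"
        using Z by (simp add: neighbourhood_base_of_closedin compact_Hausdorff_imp_regular_space)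
      then obtain V C where VC: "openin Z V" "closedin Z C" "h p \<in> V" "V \<subseteq> C" "C \<subseteq> W"
        using W p(2) unfolding neighbourhood_base_of by meson
      let ?A = "{x\<in>S. f x \<in> V}"
      have "h q \<in> W" if q: "ultrafilter_on S q" "?A \<in> q" for q
      proof (rule ccontr)
        assume "h q \<notin> W"
        then have "h q \<in> topspace Z - C" using VC h[OF q(1)] by blast
        then have "{x\<in>S. f x \<in> topspace Z - C} \<in> q"
          using hW[OF q(1), of "topspace Z - C"] VC(2) unfolding closedin_def by blast
        then show False using ultrafilter_on_disjoint[OF q] VC(4) by blast
      qed
      then have "ultrafilters_containing S ?A \<subseteq> {p \<in> topspace (stone_cech S). h p \<in> W}"
        by (auto simp: topspace_stone_cech ultrafilters_containing_def)
      moreover have "openin (stone_cech S) (ultrafilters_containing S ?A)"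
        by (rule openin_ultrafilters_containing) auto
      moreover have "p \<in> ultrafilters_containing S ?A"
        using p hW[OF p(1) VC(1,3)] by (simp add: ultrafilters_containing_def)
      ultimately show "\<exists>T. openin (stone_cech S) T \<and> p \<in> T \<and>
          T \<subseteq> {p \<in> topspace (stone_cech S). h p \<in> W}" by blast
    qed
  qed
  ultimately show ?thesis by blast
qed

lemma stone_cech_extension_unique:
  assumes "Hausdorff_space Z" "continuous_map (stone_cech S) Z h" "continuous_map (stone_cech S) Z h'"
    and "\<And>x. x \<in> S \<Longrightarrow> h (principal_ultrafilter S x) = h' (principal_ultrafilter S x)"
    and "p \<in> topspace (stone_cech S)"
  shows "h p = h' p"
proof (rule forall_in_closure_of_eq[OF _ assms(1-3)])
  show "p \<in> stone_cech S closure_of (principal_ultrafilter S ` S)"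
    using assms(5) by (simp add: stone_cech_dense)
  show "h x = h' x" if "x \<in> principal_ultrafilter S ` S" for x
    using that assms(4) by blast
qed


section \<open>The group action\<close>

text \<open>
  The topology on \<open>G\<close> is discrete, so it is not recorded. The lemmas following the
  definition show that \<open>stone_cech_action G g\<close> is the continuous extension of left
  multiplication by \<open>g\<close> (unique by the lemma above) and that this gives an action.
\<close>

definition stone_cech_action ::
    "('a, 'b) monoid_scheme \<Rightarrow> 'a \<Rightarrow> 'a set set \<Rightarrow> 'a set set" where
  "stone_cech_action G g p = (\<lambda>A. g <#\<^bsub>G\<^esub> A) ` p"

context group
begin

lemma l_coset_eq_image: "g <#\<^bsub>G\<^esub> A = (\<lambda>x. g \<otimes> x) ` A"
  by (auto simp: l_coset_def)

lemma l_coset_Diff: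
  assumes "g \<in> carrier G" "A \<subseteq> carrier G" "B \<subseteq> carrier G"
  shows "g <#\<^bsub>G\<^esub> (A - B) = (g <#\<^bsub>G\<^esub> A) - (g <#\<^bsub>G\<^esub> B)"
  unfolding l_coset_eq_image
  using assms by (intro inj_on_image_set_diff[of _ "carrier G"]) (auto simp: inj_on_cmult)

lemma l_coset_Int:
  assumes "g \<in> carrier G" "A \<subseteq> carrier G" "B \<subseteq> carrier G"
  shows "g <#\<^bsub>G\<^esub> (A \<inter> B) = (g <#\<^bsub>G\<^esub> A) \<inter> (g <#\<^bsub>G\<^esub> B)"
  unfolding l_coset_eq_image
  using assms by (intro inj_on_image_Int[of _ "carrier G"]) (auto simp: inj_on_cmult)

lemma l_coset_inv_cancel:
  assumes "g \<in> carrier G" "A \<subseteq> carrier G"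
  shows "g <#\<^bsub>G\<^esub> (inv g <#\<^bsub>G\<^esub> A) = A" "inv g <#\<^bsub>G\<^esub> (g <#\<^bsub>G\<^esub> A) = A"
  using assms lcos_m_assoc[OF assms(2), of g "inv g"] lcos_m_assoc[OF assms(2), of "inv g" g]
    lcos_mult_one[OF assms(2)]
  by simp_all

lemma in_stone_cech_action_iff:
  assumes g: "g \<in> carrier G" and p: "ultrafilter_on (carrier G) p" and B: "B \<subseteq> carrier G"
  shows "B \<in> stone_cech_action G g p \<longleftrightarrow> inv g <#\<^bsub>G\<^esub> B \<in> p"
proof
  assume "B \<in> stone_cech_action G g p"
  then obtain A where A: "A \<in> p" "B = g <#\<^bsub>G\<^esub> A" unfolding stone_cech_action_def by blast
  then show "inv g <#\<^bsub>G\<^esub> B \<in> p"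
    using l_coset_inv_cancel(2)[OF g ultrafilter_onD(1)[OF p A(1)]] by simp
next
  assume "inv g <#\<^bsub>G\<^esub> B \<in> p"
  then show "B \<in> stone_cech_action G g p"
    using l_coset_inv_cancel(1)[OF g B] unfolding stone_cech_action_def by (metis imageI)
qed

lemma ultrafilter_on_stone_cech_action:
  assumes g: "g \<in> carrier G" and p: "ultrafilter_on (carrier G) p"
  shows "ultrafilter_on (carrier G) (stone_cech_action G g p)"
proof -
  have sub: "A \<subseteq> carrier G" if A: "A \<in> stone_cech_action G g p" for A
  proof -
    obtain B where B: "B \<in> p" "A = g <#\<^bsub>G\<^esub> B" using A unfolding stone_cech_action_def by blast
    then show ?thesis using l_coset_subset_G[OF ultrafilter_onD(1)[OF p B(1)] g] by simp
  qed
  note iff = in_stone_cech_action_iff[OF g p]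
  have ig: "inv g \<in> carrier G" using g by simp
  have ic: "inv g <#\<^bsub>G\<^esub> carrier G = carrier G"
    using coset_join3[OF ig subgroup_self ig] .
  show ?thesis
    unfolding ultrafilter_on_def
  proof (intro conjI ballI allI impI)
    show "stone_cech_action G g p \<subseteq> Pow (carrier G)" using sub by blast
    show "carrier G \<in> stone_cech_action G g p" using iff ic ultrafilter_onD(2)[OF p] by simp
    show "{} \<notin> stone_cech_action G g p" using iff ultrafilter_onD(3)[OF p] by (simp add: l_coset_def)
    show "A \<inter> B \<in> stone_cech_action G g p"
      if "A \<in> stone_cech_action G g p" "B \<in> stone_cech_action G g p" for A B
    proof -
      have AB: "A \<subseteq> carrier G" "B \<subseteq> carrier G" using sub that by auto
      then have "inv g <#\<^bsub>G\<^esub> A \<in> p" "inv g <#\<^bsub>G\<^esub> B \<in> p" using that iff by auto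
      then have "inv g <#\<^bsub>G\<^esub> (A \<inter> B) \<in> p"
        using l_coset_Int[OF ig AB] ultrafilter_onD(4)[OF p] by simp
      then show ?thesis using iff[of "A \<inter> B"] AB by blast
    qed
    show "B \<in> stone_cech_action G g p"
      if AB: "A \<in> stone_cech_action G g p" "A \<subseteq> B \<and> B \<subseteq> carrier G" for A B
    proof -
      have "inv g <#\<^bsub>G\<^esub> A \<subseteq> inv g <#\<^bsub>G\<^esub> B" using AB by (auto simp: l_coset_def)
      moreover have "inv g <#\<^bsub>G\<^esub> A \<in> p" using AB(1) iff[OF sub[OF AB(1)]] by simp
      moreover have "inv g <#\<^bsub>G\<^esub> B \<subseteq> carrier G" using AB(2) by (intro l_coset_subset_G[OF _ ig]) simp
      ultimately have "inv g <#\<^bsub>G\<^esub> B \<in> p" using ultrafilter_onD(5)[OF p] by blast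
      then show ?thesis using AB(2) iff[of B] by simp
    qed
    show "A \<in> stone_cech_action G g p \<or> carrier G - A \<in> stone_cech_action G g p"
      if A: "A \<subseteq> carrier G" for A
      using iff[OF A] iff[of "carrier G - A"] l_coset_Diff[OF ig order_refl A] ic
        ultrafilter_onD(6)[OF p l_coset_subset_G[OF A ig]] by auto
  qed
qed

lemma continuous_map_stone_cech_action:
  assumes g: "g \<in> carrier G"
  shows "continuous_map (stone_cech (carrier G)) (stone_cech (carrier G)) (stone_cech_action G g)"
proof -
  have "openin (stone_cech (carrier G)) {p \<in> topspace (stone_cech (carrier G)). stone_cech_action G g p \<in> W}"
    if W: "openin (stone_cech (carrier G)) W" for W
  proof (subst openin_subopen, intro ballI)
    fix p assume "p \<in> {p \<in> topspace (stone_cech (carrier G)). stone_cech_action G g p \<in> W}"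
    then have p: "ultrafilter_on (carrier G) p" "stone_cech_action G g p \<in> W"
      by (auto simp: topspace_stone_cech)
    then obtain A where A: "A \<in> stone_cech_action G g p" "ultrafilters_containing (carrier G) A \<subseteq> W"
      using stone_cech_base W by blast
    then have AG: "A \<subseteq> carrier G"
      using ultrafilter_onD(1)[OF ultrafilter_on_stone_cech_action[OF g p(1)]] by blast
    let ?T = "ultrafilters_containing (carrier G) (inv g <#\<^bsub>G\<^esub> A)"
    have "openin (stone_cech (carrier G)) ?T"
      using AG g by (intro openin_ultrafilters_containing l_coset_subset_G) auto
    moreover have "p \<in> ?T"
      using A(1) AG p(1) in_stone_cech_action_iff[OF g p(1)] by (simp add: ultrafilters_containing_def)
    moreover have "?T \<subseteq> {p \<in> topspace (stone_cech (carrier G)). stone_cech_action G g p \<in> W}"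
    proof
      fix q assume "q \<in> ?T"
      then have q: "ultrafilter_on (carrier G) q" "inv g <#\<^bsub>G\<^esub> A \<in> q"
        by (simp_all add: ultrafilters_containing_def)
      then have "stone_cech_action G g q \<in> ultrafilters_containing (carrier G) A"
        using in_stone_cech_action_iff[OF g q(1) AG] ultrafilter_on_stone_cech_action[OF g q(1)]
        by (simp add: ultrafilters_containing_def)
      then show "q \<in> {p \<in> topspace (stone_cech (carrier G)). stone_cech_action G g p \<in> W}"
        using A(2) q(1) by (auto simp: topspace_stone_cech)
    qed
    ultimately show "\<exists>T. openin (stone_cech (carrier G)) T \<and> p \<in> T \<and>
        T \<subseteq> {p \<in> topspace (stone_cech (carrier G)). stone_cech_action G g p \<in> W}" by blast
  qed
  then show ?thesis
    using ultrafilter_on_stone_cech_action[OF g]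
    unfolding continuous_map by (auto simp: topspace_stone_cech)
qed

lemma stone_cech_action_principal:
  assumes g: "g \<in> carrier G" and x: "x \<in> carrier G"
  shows "stone_cech_action G g (principal_ultrafilter (carrier G) x)
       = principal_ultrafilter (carrier G) (g \<otimes> x)"
proof -
  let ?p = "principal_ultrafilter (carrier G) x"
  note p = ultrafilter_on_principal[OF x]
  have *: "B \<in> stone_cech_action G g ?p \<longleftrightarrow> g \<otimes> x \<in> B" if B: "B \<subseteq> carrier G" for B
  proof -
    have "B \<in> stone_cech_action G g ?p \<longleftrightarrow> x \<in> inv g <#\<^bsub>G\<^esub> B"
      unfolding in_stone_cech_action_iff[OF g p B]
      using l_coset_subset_G[OF B inv_closed[OF g]] by (simp add: principal_ultrafilter_def)
    also have "\<dots> \<longleftrightarrow> g \<otimes> x \<in> B"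
    proof
      assume "x \<in> inv g <#\<^bsub>G\<^esub> B"
      then obtain b where b: "b \<in> B" "x = inv g \<otimes> b" unfolding l_coset_eq_image by blast
      have "b \<in> carrier G" using b(1) B by blast
      then have "g \<otimes> (inv g \<otimes> b) = b" using m_assoc[of g "inv g" b] g by simp
      then show "g \<otimes> x \<in> B" using b by simp
    next
      assume "g \<otimes> x \<in> B"
      then have "inv g \<otimes> (g \<otimes> x) \<in> inv g <#\<^bsub>G\<^esub> B"
        unfolding l_coset_eq_image by (rule imageI)
      moreover have "inv g \<otimes> (g \<otimes> x) = x" using m_assoc[of "inv g" g x] g x by simp
      ultimately show "x \<in> inv g <#\<^bsub>G\<^esub> B" by simp
    qed
    finally show ?thesis .
  qed
  show ?thesis
  proof (rule Set.set_eqI)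
    fix B
    have "B \<subseteq> carrier G" if "B \<in> stone_cech_action G g ?p"
      by (rule ultrafilter_onD(1)[OF ultrafilter_on_stone_cech_action[OF g p] that])
    then show "B \<in> stone_cech_action G g ?p \<longleftrightarrow> B \<in> principal_ultrafilter (carrier G) (g \<otimes> x)"
      using *[of B] unfolding principal_ultrafilter_def mem_Collect_eq by metis
  qed
qed

lemma stone_cech_action_one:
  assumes "ultrafilter_on (carrier G) p"
  shows "stone_cech_action G \<one> p = p"
  unfolding stone_cech_action_def
  using image_cong[OF refl lcos_mult_one[OF ultrafilter_onD(1)[OF assms]], of p "\<lambda>A. A"] by simp

lemma stone_cech_action_mult:
  assumes "g \<in> carrier G" "h \<in> carrier G" "ultrafilter_on (carrier G) p"
  shows "stone_cech_action G (g \<otimes> h) p = stone_cech_action G g (stone_cech_action G h p)"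
  unfolding stone_cech_action_def image_image
  using lcos_m_assoc[OF ultrafilter_onD(1)[OF assms(3)] assms(1,2)] by (intro image_cong) simp_all

end

definition cocompact_action ::
    "('a, 'b) monoid_scheme \<Rightarrow> 'c topology \<Rightarrow> ('a \<Rightarrow> 'c \<Rightarrow> 'c) \<Rightarrow> bool" where
  "cocompact_action G X \<phi> \<longleftrightarrow>
     (\<exists>K. compactin X K \<and> (\<Union>g\<in>carrier G. \<phi> g ` K) = topspace X)"

definition stone_cech_closure :: "('a, 'b) monoid_scheme \<Rightarrow> 'a set \<Rightarrow> 'a set set set" where
  "stone_cech_closure G B =
     stone_cech (carrier G) closure_of (principal_ultrafilter (carrier G) ` B)"

definition translates_closure :: "('a, 'b) monoid_scheme \<Rightarrow> 'a set \<Rightarrow> 'a set set set" where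
  "translates_closure G A = (\<Union>g\<in>carrier G. stone_cech_closure G (g <#\<^bsub>G\<^esub> A))"

end

theory Submission
  imports Defs
begin

text \<open>
  The closures of subsets of \<open>G\<close> are exactly the basic open sets of the Stone--Cech
  compactification, and they are stable under finite unions. A compact set \<open>K \<subseteq> U\<close> whose
  translates cover \<open>U\<close> therefore fits into the closure of a single \<open>A\<close> with
  \<open>K \<subseteq> closure A \<subseteq> U\<close>, and translating this chain by all elements of \<open>G\<close> gives the claim.
\<close>

text \<open>The substantial inclusion is primeness: an ultrafilter containing a finite union
  contains one of its members. The converse is upward closure.\<close>

lemma ultrafilters_containing_Union:
  assumes "finite \<F>" "\<F> \<subseteq> Pow S"
  shows "ultrafilters_containing S (\<Union>\<F>) = (\<Union>A\<in>\<F>. ultrafilters_containing S A)"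
proof (intro equalityI subsetI)
  fix p assume "p \<in> ultrafilters_containing S (\<Union>\<F>)"
  then show "p \<in> (\<Union>A\<in>\<F>. ultrafilters_containing S A)"
    using ultrafilter_on_Union[OF _ assms] by (auto simp: ultrafilters_containing_def)
next
  fix p assume "p \<in> (\<Union>A\<in>\<F>. ultrafilters_containing S A)"
  then obtain A where "A \<in> \<F>" and p: "ultrafilter_on S p" "A \<in> p"
    by (auto simp: ultrafilters_containing_def)
  then have "\<Union>\<F> \<in> p" using assms(2) by (intro ultrafilter_onD(5)[OF p]) auto
  then show "p \<in> ultrafilters_containing S (\<Union>\<F>)"
    using p by (simp add: ultrafilters_containing_def)
qed

text \<open>If \<open>A \<notin> p\<close>, the ultrafilters containing \<open>S - A\<close> form a
  neighbourhood of \<open>p\<close> that misses every principal ultrafilter at a point of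
  \<open>A\<close>. If \<open>A \<in> p\<close>, a basic neighbourhood given by
  \<open>B \<in> p\<close> contains the principal ultrafilter at any point of
  \<open>A \<inter> B\<close>, which is nonempty.\<close>

lemma closure_of_principal_ultrafilters:
  assumes A: "A \<subseteq> S"
  shows "stone_cech S closure_of (principal_ultrafilter S ` A) = ultrafilters_containing S A"
proof (intro equalityI subsetI)
  fix p assume p: "p \<in> stone_cech S closure_of (principal_ultrafilter S ` A)"
  then have u: "ultrafilter_on S p"
    using closure_of_subset_topspace by (fastforce simp: topspace_stone_cech)
  have "A \<in> p"
  proof (rule ccontr)
    assume "A \<notin> p"
    then have "p \<in> ultrafilters_containing S (S - A)"
      using ultrafilter_onD(6)[OF u A] u by (simp add: ultrafilters_containing_def)
    then obtain x where "x \<in> A" "principal_ultrafilter S x \<in> ultrafilters_containing S (S - A)"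
      using p openin_ultrafilters_containing[of "S - A" S] unfolding in_closure_of by blast
    then show False by (simp add: ultrafilters_containing_def principal_ultrafilter_def)
  qed
  then show "p \<in> ultrafilters_containing S A" using u by (simp add: ultrafilters_containing_def)
next
  fix p assume "p \<in> ultrafilters_containing S A"
  then have p: "ultrafilter_on S p" "A \<in> p" by (simp_all add: ultrafilters_containing_def)
  have "\<exists>y. y \<in> principal_ultrafilter S ` A \<and> y \<in> T"
    if T: "p \<in> T" "openin (stone_cech S) T" for T
  proof -
    obtain B where B: "B \<in> p" "ultrafilters_containing S B \<subseteq> T" using stone_cech_base T by blast
    obtain x where x: "x \<in> A" "x \<in> B" using ultrafilter_on_disjoint[OF p B(1)] by blast
    then have "principal_ultrafilter S x \<in> ultrafilters_containing S B"
      using A ultrafilter_on_principal[of x S] ultrafilter_onD(1)[OF p(1) B(1)]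
      by (auto simp: ultrafilters_containing_def principal_ultrafilter_def)
    then show ?thesis using x(1) B(2) by blast
  qed
  then show "p \<in> stone_cech S closure_of (principal_ultrafilter S ` A)"
    using p(1) unfolding in_closure_of topspace_stone_cech by blast
qed

lemma compactin_stone_cech_subset_openin:
  assumes K: "compactin (stone_cech S) K" and U: "openin (stone_cech S) U" and "K \<subseteq> U"
  obtains A where "A \<subseteq> S" "K \<subseteq> ultrafilters_containing S A" "ultrafilters_containing S A \<subseteq> U"
proof -
  \<comment> \<open>All basic open sets lying inside \<open>U\<close>. They cover \<open>K\<close>,
    and compactness leaves finitely many of them, whose index sets are merged into the single set
    \<open>\<Union>\<F>\<close>.\<close>
  define \<B> where "\<B> = {A. A \<subseteq> S \<and> ultrafilters_containing S A \<subseteq> U}"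
  have "K \<subseteq> \<Union>(ultrafilters_containing S ` \<B>)"
  proof
    fix p assume "p \<in> K"
    then have "p \<in> U" and p: "ultrafilter_on S p"
      using \<open>K \<subseteq> U\<close> compactin_subset_topspace[OF K] by (auto simp: topspace_stone_cech)
    then obtain A where "A \<in> p" "ultrafilters_containing S A \<subseteq> U" using stone_cech_base[OF U] by blast
    then show "p \<in> \<Union>(ultrafilters_containing S ` \<B>)"
      using p ultrafilter_onD(1)[OF p] by (auto simp: \<B>_def ultrafilters_containing_def)
  qed
  moreover have "openin (stone_cech S) V" if "V \<in> ultrafilters_containing S ` \<B>" for V
    using that openin_ultrafilters_containing by (auto simp: \<B>_def)
  ultimately obtain \<C> where "finite \<C>" "\<C> \<subseteq> ultrafilters_containing S ` \<B>" "K \<subseteq> \<Union>\<C>"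
    using compactinD[OF K, of "ultrafilters_containing S ` \<B>"] by blast
  then obtain \<F> where \<F>: "finite \<F>" "\<F> \<subseteq> \<B>" "K \<subseteq> (\<Union>A\<in>\<F>. ultrafilters_containing S A)"
    by (metis finite_subset_image)
  then have eq: "ultrafilters_containing S (\<Union>\<F>) = (\<Union>A\<in>\<F>. ultrafilters_containing S A)"
    by (intro ultrafilters_containing_Union) (auto simp: \<B>_def)
  show thesis
  proof (rule that[of "\<Union>\<F>"])
    show "\<Union>\<F> \<subseteq> S" using \<F>(2) by (auto simp: \<B>_def)
    show "K \<subseteq> ultrafilters_containing S (\<Union>\<F>)" using \<F>(3) eq by simp
    show "ultrafilters_containing S (\<Union>\<F>) \<subseteq> U" using \<F>(2) unfolding eq by (auto simp: \<B>_def)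
  qed
qed

context group
begin

text \<open>Translating an ultrafilter translates its members, which gives one inclusion for every
  group element; the reverse one follows by applying it to \<open>inv g\<close>.\<close>

lemma stone_cech_action_ultrafilters_containing:
  assumes g: "g \<in> carrier G" and A: "A \<subseteq> carrier G"
  shows "stone_cech_action G g ` ultrafilters_containing (carrier G) A
       = ultrafilters_containing (carrier G) (g <#\<^bsub>G\<^esub> A)"
proof -
  have sub: "stone_cech_action G h ` ultrafilters_containing (carrier G) B
      \<subseteq> ultrafilters_containing (carrier G) (h <#\<^bsub>G\<^esub> B)" if h: "h \<in> carrier G" for h B
    using ultrafilter_on_stone_cech_action[OF h]
    by (auto simp: ultrafilters_containing_def) (simp add: stone_cech_action_def)
  have "ultrafilters_containing (carrier G) (g <#\<^bsub>G\<^esub> A)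
      \<subseteq> stone_cech_action G g ` ultrafilters_containing (carrier G) A"
  proof
    fix p assume p: "p \<in> ultrafilters_containing (carrier G) (g <#\<^bsub>G\<^esub> A)"
    then have u: "ultrafilter_on (carrier G) p" by (simp add: ultrafilters_containing_def)
    have "stone_cech_action G (inv g) p \<in> ultrafilters_containing (carrier G) A"
      using sub[OF inv_closed[OF g], of "g <#\<^bsub>G\<^esub> A"] p l_coset_inv_cancel(2)[OF g A] by auto
    moreover have "p = stone_cech_action G g (stone_cech_action G (inv g) p)"
      using stone_cech_action_mult[OF g inv_closed[OF g] u] stone_cech_action_one[OF u] g by simp
    ultimately show "p \<in> stone_cech_action G g ` ultrafilters_containing (carrier G) A" by blast
  qed
  then show ?thesis using sub[OF g] by blast
qed

text \<open>This exhibits \<open>X_A\<close> as the union of the translates of one basic set, so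
  that inclusions involving that set can be moved around by the action.\<close>

lemma translates_closure_eq:
  assumes A: "A \<subseteq> carrier G"
  shows "translates_closure G A
       = (\<Union>g\<in>carrier G. stone_cech_action G g ` ultrafilters_containing (carrier G) A)"
  unfolding translates_closure_def stone_cech_closure_def
  using closure_of_principal_ultrafilters[OF l_coset_subset_G[OF A]]
    stone_cech_action_ultrafilters_containing[OF _ A]
  by simp

end

theorem proposition2p7:
  fixes G :: "('a, 'b) monoid_scheme" and U :: "'a set set set"
  assumes "group G"
    and "openin (stone_cech (carrier G)) U" and "U \<noteq> {}"
    and "\<And>g. g \<in> carrier G \<Longrightarrow> stone_cech_action G g ` U \<subseteq> U"
    and "cocompact_action G (subtopology (stone_cech (carrier G)) U) (stone_cech_action G)"
  shows "\<exists>A. A \<noteq> {} \<and> A \<subseteq> carrier G \<and> U = translates_closure G A"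
proof -
  interpret group G by fact
  let ?C = "ultrafilters_containing (carrier G)"
  \<comment> \<open>This turns co-compactness of the action on the subspace into a compact subset of
    the whole compactification that lies in \<open>U\<close> and whose translates have union exactly
    \<open>U\<close>.\<close>
  have "topspace (subtopology (stone_cech (carrier G)) U) = U"
    using openin_subset[OF assms(2)] by auto
  then obtain K where K: "compactin (stone_cech (carrier G)) K" "K \<subseteq> U"
    and cover: "(\<Union>g\<in>carrier G. stone_cech_action G g ` K) = U"
    using assms(5) unfolding cocompact_action_def compactin_subtopology by auto
  obtain A where A: "A \<subseteq> carrier G" "K \<subseteq> ?C A" "?C A \<subseteq> U"
    using compactin_stone_cech_subset_openin[OF K(1) assms(2) K(2)] .
  have "U \<subseteq> translates_closure G A"
    using A(2) unfolding translates_closure_eq[OF A(1)] cover[symmetric] by blast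
  \<comment> \<open>Here the invariance of \<open>U\<close> enters: each translate of
    \<open>?C A\<close> stays inside \<open>U\<close>.\<close>
  moreover have "translates_closure G A \<subseteq> U"
    using A(3) assms(4) unfolding translates_closure_eq[OF A(1)] by blast
  moreover have "A \<noteq> {}"
  proof
    assume "A = {}"
    \<comment> \<open>No ultrafilter contains the empty set, so \<open>?C {}\<close> is empty and so
      is \<open>K\<close>; its translates then cannot cover the nonempty \<open>U\<close>.\<close>
    then have "K = {}" using A(2) ultrafilter_onD(3) by (auto simp: ultrafilters_containing_def)
    then show False using cover assms(3) by simp
  qed
  ultimately show ?thesis using A(1) by blast
qed

end
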